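(* Consider the one-dimensional nearest-neighbour Ising model with coupling $K>0$, no external field ($h=0$) and periodic boundary conditions, in the thermodynamic limit. Let $f,g:\{+1,-1\}\to\mathbb{R}$ and let $x_1=i$, $x_2=j$ be lattice sites in $\mathbb{Z}$. Let $\mathcal{S}^{fg}=\hat{\mathcal{S}}^{fg}-\tilde{\mathcal{S}}^{fg}$ be the two point observable induced by $fg$. Then $$\hat{\mathcal{S}}^{fg}=\frac{A}{4}+\frac{B}{4}\left(\frac{\lambda_-}{\lambda_+}\right)^{|x_2-x_1|},$$ $$\tilde{\mathcal{S}}^{fg}=\left(\frac{C^{4}_{12}C^{2}_{12}}{4}+\frac{\bar\Delta}{4}\left(\frac{\lambda_-}{\lambda_+}\right)^{|x_2-x_1|}\right)\log\left(\frac{C^{4}_{12}C^{2}_{12}}{4}+\frac{\bar\Delta}{4}\left(\frac{\lambda_-}{\lambda_+}\right)^{|x_2-x_1|}\right),$$ where $A=a+b+c+d$, $B=a-b-c+d$, $C^2_{12}=g^2(1)+g^2(-1)$, $C^4_{12}=f^2(1)+f^2(-1)$, $\bar\Delta=(f^2(1)-f^2(-1))(g^2(1)-g^2(-1))$, and $a=f^2(1)g^2(1)\log(f^2(1)g^2(1))$, $b=f^2(-1)g^2(1)\log(f^2(-1)g^2(1))$, $c=f^2(1)g^2(-1)\log(f^2(1)g^2(-1))$, $d=f^2(-1)g^2(-1)\log(f^2(-1)g^2(-1))$.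
   Context: For $N\ge 1$ let $\mathbb{P}_N$ be the probability measure on $\{\pm1\}^N$ given by $\mathbb{P}_N(\sigma)=Z_N^{-1}\exp\{K\sum_{k=1}^N\sigma_k\sigma_{k+1}\}$ with $\sigma_{N+1}=\sigma_1$ (indices modulo $N$), where $Z_N$ is the normalizing constant (partition function). $\langle\cdot\rangle_{\mathbb{P}_N}$ denotes expectation under $\mathbb{P}_N$. The two point observable is defined by $$\hat{\mathcal{S}}^{fg}=\lim_{N\to\infty}\langle f^2(\sigma_{x_1})g^2(\sigma_{x_2})\log(f^2(\sigma_{x_1})g^2(\sigma_{x_2}))\rangle_{\mathbb{P}_N},$$ $$\tilde{\mathcal{S}}^{fg}=\lim_{N\to\infty}\langle f^2(\sigma_{x_1})g^2(\sigma_{x_2})\rangle_{\mathbb{P}_N}\log\langle f^2(\sigma_{x_1})g^2(\sigma_{x_2})\rangle_{\mathbb{P}_N},$$ and $\mathcal{S}^{fg}=\hat{\mathcal{S}}^{fg}-\tilde{\mathcal{S}}^{fg}$. Here $\lambda_+=e^K+e^{-K}$ and $\lambda_-=e^K-e^{-K}$. Convention: $0\log 0=0$. *)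

theory Defs
  imports "HOL-Probability.Probability_Measure"
begin

text \<open>
  The finite-volume lattice is \<open>{1..N}\<close> with periodic boundary conditions, and a configuration is an
  element of \<open>{1..N} \<rightarrow>\<^sub>E {1, -1}\<close>.  An arbitrary site \<open>x\<close> of the integer lattice
  is identified with its representative modulo \<open>N\<close> in \<open>{1..N}\<close>; in particular the site
  \<open>N + 1\<close> is the site \<open>1\<close>.
\<close>

definition spin_configs :: "nat \<Rightarrow> (int \<Rightarrow> int) set" where
  "spin_configs N = {1..int N} \<rightarrow>\<^sub>E {1, -1}"

definition spin :: "nat \<Rightarrow> (int \<Rightarrow> int) \<Rightarrow> int \<Rightarrow> int" where
  "spin N \<sigma> x = \<sigma> ((x - 1) mod int N + 1)"

definition boltzmann_weight :: "real \<Rightarrow> nat \<Rightarrow> (int \<Rightarrow> int) \<Rightarrow> real" where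
  "boltzmann_weight K N \<sigma> =
     exp (K * (\<Sum>k = 1..int N. real_of_int (spin N \<sigma> k * spin N \<sigma> (k + 1))))"

definition partition_function :: "real \<Rightarrow> nat \<Rightarrow> real" where
  "partition_function K N = (\<Sum>\<sigma>\<in>spin_configs N. boltzmann_weight K N \<sigma>)"

definition ising_measure :: "real \<Rightarrow> nat \<Rightarrow> (int \<Rightarrow> int) measure" where
  "ising_measure K N =
     point_measure (spin_configs N)
       (\<lambda>\<sigma>. ennreal (boltzmann_weight K N \<sigma> / partition_function K N))"

lemma prob_space_ising_measure: "prob_space (ising_measure K N)"
proof
  have fin: "finite (spin_configs N)"
    unfolding spin_configs_def by (intro finite_PiE) auto
  have ne: "spin_configs N \<noteq> {}"
    unfolding spin_configs_def by (simp add: PiE_eq_empty_iff)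
  have pos: "partition_function K N > 0"
    unfolding partition_function_def using fin ne
    by (intro sum_pos) (auto simp: boltzmann_weight_def)
  have "emeasure (ising_measure K N) (space (ising_measure K N)) =
      (\<Sum>\<sigma>\<in>spin_configs N. ennreal (boltzmann_weight K N \<sigma> / partition_function K N))"
    unfolding ising_measure_def space_point_measure
    by (rule emeasure_point_measure_finite) (use fin in auto)
  also have "\<dots> = ennreal (\<Sum>\<sigma>\<in>spin_configs N. boltzmann_weight K N \<sigma> / partition_function K N)"
    using pos by (intro sum_ennreal) (auto simp: boltzmann_weight_def)
  also have "\<dots> = 1"
    using pos by (simp add: partition_function_def flip: sum_divide_distrib)
  finally show "emeasure (ising_measure K N) (space (ising_measure K N)) = 1" .
qed

definition ising_expectation :: "real \<Rightarrow> nat \<Rightarrow> ((int \<Rightarrow> int) \<Rightarrow> real) \<Rightarrow> real" where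
  "ising_expectation K N F = (\<integral>\<sigma>. F \<sigma> \<partial>ising_measure K N)"

text \<open>
  Only the values of \<open>f\<close> and \<open>g\<close> at \<open>1\<close> and \<open>-1\<close> matter.  The convention \<open>0 log 0 = 0\<close>
  holds automatically for \<^const>\<open>ln\<close> on the reals.  The term at \<open>N = 0\<close> of the sequences is
  irrelevant to their limits.
\<close>

definition S_hat_seq ::
  "real \<Rightarrow> (int \<Rightarrow> real) \<Rightarrow> (int \<Rightarrow> real) \<Rightarrow> int \<Rightarrow> int \<Rightarrow> nat \<Rightarrow> real" where
  "S_hat_seq K f g x1 x2 N =
     ising_expectation K N
       (\<lambda>\<sigma>. (f (spin N \<sigma> x1))\<^sup>2 * (g (spin N \<sigma> x2))\<^sup>2 *
            ln ((f (spin N \<sigma> x1))\<^sup>2 * (g (spin N \<sigma> x2))\<^sup>2))"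

definition S_tilde_seq ::
  "real \<Rightarrow> (int \<Rightarrow> real) \<Rightarrow> (int \<Rightarrow> real) \<Rightarrow> int \<Rightarrow> int \<Rightarrow> nat \<Rightarrow> real" where
  "S_tilde_seq K f g x1 x2 N =
     ising_expectation K N (\<lambda>\<sigma>. (f (spin N \<sigma> x1))\<^sup>2 * (g (spin N \<sigma> x2))\<^sup>2) *
     ln (ising_expectation K N (\<lambda>\<sigma>. (f (spin N \<sigma> x1))\<^sup>2 * (g (spin N \<sigma> x2))\<^sup>2))"

definition S_hat :: "real \<Rightarrow> (int \<Rightarrow> real) \<Rightarrow> (int \<Rightarrow> real) \<Rightarrow> int \<Rightarrow> int \<Rightarrow> real" where
  "S_hat K f g x1 x2 = lim (S_hat_seq K f g x1 x2)"

definition S_tilde :: "real \<Rightarrow> (int \<Rightarrow> real) \<Rightarrow> (int \<Rightarrow> real) \<Rightarrow> int \<Rightarrow> int \<Rightarrow> real" where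
  "S_tilde K f g x1 x2 = lim (S_tilde_seq K f g x1 x2)"

definition two_point_observable ::
  "real \<Rightarrow> (int \<Rightarrow> real) \<Rightarrow> (int \<Rightarrow> real) \<Rightarrow> int \<Rightarrow> int \<Rightarrow> real" where
  "two_point_observable K f g x1 x2 = S_hat K f g x1 x2 - S_tilde K f g x1 x2"

definition lambda_plus :: "real \<Rightarrow> real" where
  "lambda_plus K = exp K + exp (- K)"

definition lambda_minus :: "real \<Rightarrow> real" where
  "lambda_minus K = exp K - exp (- K)"

end

theory Submission
  imports Defs "HOL-Real_Asymp.Real_Asymp"
begin

text \<open>
  Since spins are \<open>\<plusminus>1\<close>, \<open>exp (K s s') = cosh K + sinh K s s'\<close>, and summing out one spin of a chain
  turns \<open>(a + b s u) (\<alpha> + \<beta> u s')\<close> into \<open>2 (a \<alpha> + b \<beta> s s')\<close>.  Hence a ring with bond-dependent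
  weights \<open>a\<^sub>k + b\<^sub>k \<sigma>\<^sub>k \<sigma>\<^sub>k\<^sub>+\<^sub>1\<close> has partition function \<open>2\<^sup>N (\<Prod>a\<^sub>k + \<Prod>b\<^sub>k)\<close>.  Inserting
  \<open>\<sigma>\<^sub>i \<sigma>\<^sub>j = \<Prod>\<^sub>i\<^sub>\<le>\<^sub>k\<^sub><\<^sub>j \<sigma>\<^sub>k \<sigma>\<^sub>k\<^sub>+\<^sub>1\<close> merely swaps \<open>a\<^sub>k\<close> and \<open>b\<^sub>k\<close> on the bonds between \<open>i\<close> and \<open>j\<close>,
  so the two-point correlation is \<open>(t\<^sup>n + t\<^sup>N\<^sup>-\<^sup>n) / (1 + t\<^sup>N)\<close> with \<open>t = \<lambda>\<^sub>- / \<lambda>\<^sub>+\<close> and \<open>n\<close> the distance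
  of the sites.  The magnetization vanishes by spin flip, and every function of two spins
  is a combination of \<open>1\<close>, the two spins and their product.
\<close>

section \<open>Summing out the spins of a chain\<close>

lemma sum_PiE_insert:
  assumes "x \<notin> S"
  shows "(\<Sum>\<sigma>\<in>PiE (insert x S) T. F \<sigma>) = (\<Sum>\<sigma>\<in>PiE S T. \<Sum>y\<in>T x. F (\<sigma>(x := y)))"
proof -
  have "(\<Sum>\<sigma>\<in>PiE (insert x S) T. F \<sigma>) = (\<Sum>(y, \<sigma>)\<in>T x \<times> PiE S T. F (\<sigma>(x := y)))"
    unfolding PiE_insert_eq
    by (subst sum.reindex) (use assms in \<open>auto intro: inj_combinator simp: case_prod_beta\<close>)
  also have "\<dots> = (\<Sum>y\<in>T x. \<Sum>\<sigma>\<in>PiE S T. F (\<sigma>(x := y)))"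
    by (simp add: sum.cartesian_product)
  also have "\<dots> = (\<Sum>\<sigma>\<in>PiE S T. \<Sum>y\<in>T x. F (\<sigma>(x := y)))"
    by (rule sum.swap)
  finally show ?thesis .
qed

text \<open>The factor with \<open>\<alpha>\<close> and \<open>\<beta>\<close> is the bond closing
  the chain. Summing out the last spin merges the last ordinary bond with it into a new closing
  bond, so the induction must run over arbitrary \<open>\<alpha>\<close> and
  \<open>\<beta>\<close>.\<close>

lemma sum_chain:
  fixes a b :: "int \<Rightarrow> real"
  shows "(\<Sum>\<sigma>\<in>{1..int (Suc n)} \<rightarrow>\<^sub>E {1, -1::int}.
      (\<Prod>k = 1..int n. a k + b k * real_of_int (\<sigma> k * \<sigma> (k + 1))) *
      (\<alpha> + \<beta> * real_of_int (\<sigma> (int (Suc n)) * \<sigma> 1)))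
    = 2 ^ Suc n * ((\<Prod>k = 1..int n. a k) * \<alpha> + (\<Prod>k = 1..int n. b k) * \<beta>)"
proof (induction n arbitrary: \<alpha> \<beta>)
  case 0
  \<comment> \<open>With a single site the closing bond joins site 1 to itself, and its spin squares
    to 1.\<close>
  have *: "{1..int (Suc 0)} = insert 1 {}" by auto
  show ?case unfolding * by (subst sum_PiE_insert) auto
next
  case (Suc n)
  define m where "m = int (Suc n)"
  have m: "m \<ge> 1" "int (Suc (Suc n)) = m + 1" by (auto simp: m_def)
  have ins: "{1..m + 1} = insert (m + 1) {1..m}" "{1..m} = insert m {1..int n}"
    by (auto simp: m_def)
  let ?W = "\<lambda>\<sigma>. \<Prod>k = 1..int n. a k + b k * real_of_int (\<sigma> k * \<sigma> (k + 1))"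
  \<comment> \<open>Only bond \<open>m\<close> and the closing bond see the spin \<open>y\<close> at
    \<open>m + 1\<close>. In the sum over \<open>y\<close> the terms linear in \<open>y\<close>
    cancel and the others double.\<close>
  have step: "(\<Sum>y\<in>{1, -1::int}.
        (\<Prod>k = 1..m. a k + b k * real_of_int ((\<sigma>(m + 1 := y)) k * (\<sigma>(m + 1 := y)) (k + 1))) *
        (\<alpha> + \<beta> * real_of_int ((\<sigma>(m + 1 := y)) (m + 1) * (\<sigma>(m + 1 := y)) 1)))
      = ?W \<sigma> * (2 * a m * \<alpha> + 2 * b m * \<beta> * real_of_int (\<sigma> m * \<sigma> 1))"
    (is "(\<Sum>y\<in>_. ?P y * ?Q y) = _") for \<sigma> :: "int \<Rightarrow> int"
  proof -
    have "?P y = (a m + b m * real_of_int (\<sigma> m * y)) * ?W \<sigma>" for y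
    proof -
      have "(\<Prod>k = 1..int n. a k + b k * real_of_int ((\<sigma>(m + 1 := y)) k * (\<sigma>(m + 1 := y)) (k + 1)))
          = ?W \<sigma>"
        by (intro prod.cong) (auto simp: m_def)
      thus ?thesis
        unfolding ins(2) by (subst prod.insert) (auto simp: m_def)
    qed
    \<comment> \<open>Here \<open>m \<ge> 1\<close> keeps site 1 distinct from the updated site
      \<open>m + 1\<close>.\<close>
    moreover have "?Q y = \<alpha> + \<beta> * real_of_int (y * \<sigma> 1)" for y
      using m by auto
    ultimately have "?P y * ?Q y = (a m + b m * real_of_int (\<sigma> m * y)) * ?W \<sigma> *
        (\<alpha> + \<beta> * real_of_int (y * \<sigma> 1))" for y
      by presburger
    thus ?thesis
      by (simp only:) (simp add: algebra_simps)
  qed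
  have "(\<Sum>\<sigma>\<in>{1..m + 1} \<rightarrow>\<^sub>E {1, -1::int}.
      (\<Prod>k = 1..m. a k + b k * real_of_int (\<sigma> k * \<sigma> (k + 1))) *
      (\<alpha> + \<beta> * real_of_int (\<sigma> (m + 1) * \<sigma> 1))) =
    (\<Sum>\<sigma>\<in>{1..m} \<rightarrow>\<^sub>E {1, -1::int}. ?W \<sigma> * (2 * a m * \<alpha> + 2 * b m * \<beta> * real_of_int (\<sigma> m * \<sigma> 1)))"
    unfolding ins(1) by (subst sum_PiE_insert) (simp, simp only: step)
  also have "\<dots> = 2 ^ Suc n * ((\<Prod>k = 1..int n. a k) * (2 * a m * \<alpha>) + (\<Prod>k = 1..int n. b k) * (2 * b m * \<beta>))"
    unfolding m_def by (rule Suc.IH)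
  also have "\<dots> = 2 ^ Suc (Suc n) * ((\<Prod>k = 1..m. a k) * \<alpha> + (\<Prod>k = 1..m. b k) * \<beta>)"
    unfolding ins(2) by (simp add: m_def algebra_simps)
  finally show ?case
    unfolding m(2) m_def .
qed

section \<open>The periodic ring and its partition function\<close>

lemma spin_eq:
  assumes "1 \<le> k" "k \<le> int N"
  shows "spin N \<sigma> k = \<sigma> k"
  using assms by (simp add: spin_def)

lemma spin_site:
  assumes "N > 0"
  shows "(x - 1) mod int N + 1 \<in> {1..int N}"
proof -
  have "(x - 1) mod int N \<ge> 0" "(x - 1) mod int N < int N" using assms by auto
  thus ?thesis by auto
qed

lemma spin_cases:
  assumes "N > 0" "\<sigma> \<in> spin_configs N"
  shows "spin N \<sigma> x = 1 \<or> spin N \<sigma> x = -1"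
  using spin_site[OF assms(1), of x] assms(2) by (auto simp: spin_def spin_configs_def PiE_def Pi_def)

text \<open>Cutting the ring at bond \<open>N\<close>, which joins site \<open>N\<close> to site 1,
  gives a chain whose closing bond has coefficients \<open>a N\<close> and \<open>b N\<close>;
  \<open>sum_chain\<close> then applies.\<close>

lemma sum_ring:
  fixes a b :: "int \<Rightarrow> real"
  assumes "N > 0"
  shows "(\<Sum>\<sigma>\<in>spin_configs N. \<Prod>k = 1..int N. a k + b k * real_of_int (spin N \<sigma> k * spin N \<sigma> (k + 1)))
    = 2 ^ N * ((\<Prod>k = 1..int N. a k) + (\<Prod>k = 1..int N. b k))"
proof -
  obtain n where N: "N = Suc n" using assms gr0_implies_Suc by blast
  have ins: "{1..int N} = insert (int N) {1..int n}" by (auto simp: N)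
  have wrap: "spin N \<sigma> (int N + 1) = \<sigma> 1" for \<sigma> by (simp add: spin_def)
  have "(\<Prod>k = 1..int N. a k + b k * real_of_int (spin N \<sigma> k * spin N \<sigma> (k + 1)))
    = (\<Prod>k = 1..int n. a k + b k * real_of_int (\<sigma> k * \<sigma> (k + 1))) *
      (a (int N) + b (int N) * real_of_int (\<sigma> (int (Suc n)) * \<sigma> 1))" for \<sigma>
  proof -
    have "(\<Prod>k = 1..int n. a k + b k * real_of_int (spin N \<sigma> k * spin N \<sigma> (k + 1)))
      = (\<Prod>k = 1..int n. a k + b k * real_of_int (\<sigma> k * \<sigma> (k + 1)))"
      by (intro prod.cong refl) (simp add: spin_eq N)
    thus ?thesis
      unfolding ins using wrap[of \<sigma>] assms
      by (subst prod.insert) (auto simp: N spin_eq mult_ac)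
  qed
  hence "(\<Sum>\<sigma>\<in>spin_configs N. \<Prod>k = 1..int N. a k + b k * real_of_int (spin N \<sigma> k * spin N \<sigma> (k + 1)))
    = (\<Sum>\<sigma>\<in>{1..int (Suc n)} \<rightarrow>\<^sub>E {1, -1::int}.
        (\<Prod>k = 1..int n. a k + b k * real_of_int (\<sigma> k * \<sigma> (k + 1))) *
        (a (int N) + b (int N) * real_of_int (\<sigma> (int (Suc n)) * \<sigma> 1)))"
    by (simp add: spin_configs_def N)
  also have "\<dots> = 2 ^ Suc n * ((\<Prod>k = 1..int n. a k) * a (int N) + (\<Prod>k = 1..int n. b k) * b (int N))"
    by (rule sum_chain)
  also have "\<dots> = 2 ^ N * ((\<Prod>k = 1..int N. a k) + (\<Prod>k = 1..int N. b k))"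
    unfolding ins by (simp add: N mult_ac)
  finally show ?thesis .
qed

lemma boltzmann_weight_prod:
  assumes "N > 0" "\<sigma> \<in> spin_configs N"
  shows "boltzmann_weight K N \<sigma> =
    (\<Prod>k = 1..int N. cosh K + sinh K * real_of_int (spin N \<sigma> k * spin N \<sigma> (k + 1)))"
  unfolding boltzmann_weight_def sum_distrib_left
proof (subst exp_sum, simp, intro prod.cong refl)
  fix k
  show "exp (K * real_of_int (spin N \<sigma> k * spin N \<sigma> (k + 1))) =
      cosh K + sinh K * real_of_int (spin N \<sigma> k * spin N \<sigma> (k + 1))"
    using spin_cases[OF assms, of k] spin_cases[OF assms, of "k + 1"]
    by (auto simp: cosh_field_def sinh_field_def field_simps)
qed

lemma partition_function_eq:
  assumes "N > 0"
  shows "partition_function K N = 2 ^ N * (cosh K ^ N + sinh K ^ N)"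
  using sum_ring[OF assms, of "\<lambda>_. cosh K" "\<lambda>_. sinh K"]
  by (simp add: partition_function_def boltzmann_weight_prod[OF assms])

lemma finite_spin_configs: "finite (spin_configs N)"
  unfolding spin_configs_def by (intro finite_PiE) auto

lemma partition_function_pos: "partition_function K N > 0"
proof -
  have "spin_configs N \<noteq> {}"
    unfolding spin_configs_def by (simp add: PiE_eq_empty_iff)
  thus ?thesis
    unfolding partition_function_def using finite_spin_configs
    by (intro sum_pos) (auto simp: boltzmann_weight_def)
qed

lemma ising_expectation_eq:
  "ising_expectation K N F =
    (\<Sum>\<sigma>\<in>spin_configs N. boltzmann_weight K N \<sigma> * F \<sigma>) / partition_function K N"
proof -
  have "ising_expectation K N F =
    (\<Sum>\<sigma>\<in>spin_configs N. boltzmann_weight K N \<sigma> / partition_function K N * F \<sigma>)"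
    unfolding ising_expectation_def ising_measure_def
    using partition_function_pos[of K N]
    by (subst lebesgue_integral_point_measure_finite)
       (auto simp: finite_spin_configs boltzmann_weight_def less_imp_le)
  thus ?thesis by (simp add: sum_divide_distrib)
qed

section \<open>Magnetization and two-point correlation\<close>

lemma sum_boltzmann_spin:
  assumes "N > 0"
  shows "(\<Sum>\<sigma>\<in>spin_configs N. boltzmann_weight K N \<sigma> * real_of_int (spin N \<sigma> x)) = 0"
proof -
  \<comment> \<open>Restricting leaves the flipped configuration undefined off the lattice, so that
    the flip is an involution of \<open>spin_configs N\<close>.\<close>
  let ?flip = "\<lambda>\<sigma>::int \<Rightarrow> int. restrict (\<lambda>k. - \<sigma> k) {1..int N}"
  have flip: "spin N (?flip \<sigma>) y = - spin N \<sigma> y" for \<sigma> y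
    using spin_site[OF assms, of y] by (simp add: spin_def)
  have mem: "?flip \<sigma> \<in> spin_configs N" if "\<sigma> \<in> spin_configs N" for \<sigma>
    using that by (auto simp: spin_configs_def PiE_def Pi_def)
  have inv: "?flip (?flip \<sigma>) = \<sigma>" if "\<sigma> \<in> spin_configs N" for \<sigma>
    using that by (auto simp: spin_configs_def PiE_def extensional_def fun_eq_iff)
  have weight: "boltzmann_weight K N (?flip \<sigma>) = boltzmann_weight K N \<sigma>" for \<sigma>
    by (simp add: boltzmann_weight_def flip)
  have "(\<Sum>\<sigma>\<in>spin_configs N. boltzmann_weight K N \<sigma> * real_of_int (spin N \<sigma> x))
      = (\<Sum>\<sigma>\<in>spin_configs N. - (boltzmann_weight K N \<sigma> * real_of_int (spin N \<sigma> x)))"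
    by (rule sum.reindex_bij_witness[where i = ?flip and j = ?flip])
       (use mem inv in \<open>simp_all add: flip weight del: restrict_apply\<close>)
  thus ?thesis by (simp add: sum_negf)
qed

text \<open>For a bond sign \<open>s\<close> with \<open>s * s = 1\<close>, multiplying
  \<open>cosh K + sinh K * s\<close> by \<open>s\<close> gives \<open>sinh K + cosh K * s\<close>.
  This happens on the \<open>j - i\<close> bonds from \<open>i\<close> to \<open>j\<close>, and
  \<open>sum_ring\<close> evaluates the resulting ring.\<close>

lemma sum_boltzmann_pair:
  assumes "1 \<le> i" "i \<le> j" "j \<le> int N"
  shows "(\<Sum>\<sigma>\<in>spin_configs N. boltzmann_weight K N \<sigma> * real_of_int (\<sigma> i * \<sigma> j)) =
    2 ^ N * (cosh K ^ (N - nat (j - i)) * sinh K ^ nat (j - i) +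
             sinh K ^ (N - nat (j - i)) * cosh K ^ nat (j - i))"
proof -
  have N: "N > 0" using assms by auto
  let ?I = "{i..<j}"
  let ?a = "\<lambda>k. if k \<in> ?I then sinh K else cosh K"
  let ?b = "\<lambda>k. if k \<in> ?I then cosh K else sinh K"
  let ?s = "\<lambda>\<sigma> k. real_of_int (spin N \<sigma> k * spin N \<sigma> (k + 1))"
  have sub: "?I \<subseteq> {1..int N}" using assms by auto
  \<comment> \<open>Every intermediate spin occurs in two adjacent bonds and squares to 1; only the
    endpoints remain.\<close>
  have telescope: "(\<Prod>k\<in>?I. ?s \<sigma> k) = real_of_int (\<sigma> i * \<sigma> j)" if \<sigma>: "\<sigma> \<in> spin_configs N" for \<sigma>
  proof -
    have sq: "real_of_int (spin N \<sigma> x) * real_of_int (spin N \<sigma> x) = 1" for x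
      using spin_cases[OF N \<sigma>, of x] by auto
    have "(\<Prod>k\<in>{i..<i + int m}. ?s \<sigma> k) = real_of_int (spin N \<sigma> i * spin N \<sigma> (i + int m))" for m
    proof (induction m)
      case 0
      thus ?case using sq[of i] by simp
    next
      case (Suc m)
      have *: "{i..<i + int (Suc m)} = insert (i + int m) {i..<i + int m}" by auto
      have "(\<Prod>k\<in>{i..<i + int (Suc m)}. ?s \<sigma> k) =
        real_of_int (spin N \<sigma> i) * real_of_int (spin N \<sigma> (i + int m + 1)) *
        (real_of_int (spin N \<sigma> (i + int m)) * real_of_int (spin N \<sigma> (i + int m)))"
        unfolding * by (subst prod.insert, simp, simp, subst Suc.IH) (simp only: of_int_mult mult_ac)
      thus ?case by (simp add: sq add_ac)
    qed
    from this[of "nat (j - i)"] show ?thesis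
      using assms by (simp add: spin_eq)
  qed
  have swap: "boltzmann_weight K N \<sigma> * real_of_int (\<sigma> i * \<sigma> j) = (\<Prod>k = 1..int N. ?a k + ?b k * ?s \<sigma> k)"
    if \<sigma>: "\<sigma> \<in> spin_configs N" for \<sigma>
  proof -
    \<comment> \<open>Padding with factors 1 spreads the product over the whole ring, so it can be
      merged with the weight bond by bond.\<close>
    have "real_of_int (\<sigma> i * \<sigma> j) = (\<Prod>k = 1..int N. if k \<in> ?I then ?s \<sigma> k else 1)"
      using telescope[OF \<sigma>] prod.inter_restrict[of "{1..int N}" "?s \<sigma>" ?I]
      unfolding Int_absorb1[OF sub] by simp
    hence "boltzmann_weight K N \<sigma> * real_of_int (\<sigma> i * \<sigma> j) =
      (\<Prod>k = 1..int N. (cosh K + sinh K * ?s \<sigma> k) * (if k \<in> ?I then ?s \<sigma> k else 1))"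
      by (simp only: boltzmann_weight_prod[OF N \<sigma>] prod.distrib)
    also have "\<dots> = (\<Prod>k = 1..int N. ?a k + ?b k * ?s \<sigma> k)"
    proof (intro prod.cong refl)
      fix k
      show "(cosh K + sinh K * ?s \<sigma> k) * (if k \<in> ?I then ?s \<sigma> k else 1) = ?a k + ?b k * ?s \<sigma> k"
        using spin_cases[OF N \<sigma>, of k] spin_cases[OF N \<sigma>, of "k + 1"] by auto
    qed
    finally show ?thesis .
  qed
  have card: "card ({1..int N} \<inter> ?I) = nat (j - i)" "card ({1..int N} \<inter> - ?I) = N - nat (j - i)"
  proof -
    show "card ({1..int N} \<inter> ?I) = nat (j - i)" using sub by (simp add: Int_absorb1)
    have "card ({1..int N} - ?I) = N - nat (j - i)" using sub by (subst card_Diff_subset) auto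
    thus "card ({1..int N} \<inter> - ?I) = N - nat (j - i)" by (simp add: Diff_eq)
  qed
  have prods: "(\<Prod>k = 1..int N. if k \<in> ?I then p else q) = q ^ (N - nat (j - i)) * p ^ nat (j - i)"
    for p q :: real
    using card by (subst prod.If_cases) (simp_all only: finite_atLeastAtMost_int Collect_mem_eq prod_constant mult.commute)
  have "(\<Sum>\<sigma>\<in>spin_configs N. boltzmann_weight K N \<sigma> * real_of_int (\<sigma> i * \<sigma> j)) =
    2 ^ N * ((\<Prod>k = 1..int N. ?a k) + (\<Prod>k = 1..int N. ?b k))"
    using swap sum_ring[OF N, of ?a ?b] by simp
  thus ?thesis unfolding prods .
qed

text \<open>Passing to representatives in \<open>{1..N}\<close> may replace the distance
  \<open>n\<close> by the length \<open>N - n\<close> of the complementary arc, but the value is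
  symmetric under exchanging the two.\<close>

lemma sum_boltzmann_spin_spin:
  assumes "N > nat \<bar>x2 - x1\<bar>"
  defines "n \<equiv> nat \<bar>x2 - x1\<bar>"
  shows "(\<Sum>\<sigma>\<in>spin_configs N. boltzmann_weight K N \<sigma> * real_of_int (spin N \<sigma> x1 * spin N \<sigma> x2)) =
    2 ^ N * (cosh K ^ (N - n) * sinh K ^ n + sinh K ^ (N - n) * cosh K ^ n)"
proof -
  define C where "C m = 2 ^ N * (cosh K ^ (N - m) * sinh K ^ m + sinh K ^ (N - m) * cosh K ^ m)" for m
  define i where "i = (x1 - 1) mod int N + 1"
  define j where "j = (x2 - 1) mod int N + 1"
  have N: "N > 0" using assms by auto
  have ij: "i \<in> {1..int N}" "j \<in> {1..int N}"
    using spin_site[OF N] by (auto simp: i_def j_def)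
  have "(j - i) mod int N = (x2 - x1) mod int N"
    by (simp add: i_def j_def mod_diff_eq)
  then obtain q where "x2 - x1 = (j - i) + int N * q"
    by (metis mod_eqE mod_eq_dvd_iff dvdE add.commute diff_eq_eq)
  hence q: "(j - i) - (x2 - x1) = int N * (- q)" by simp
  \<comment> \<open>Both differences are smaller than \<open>N\<close> in absolute value, so the
    winding number \<open>q\<close> can only be -1, 0 or 1.\<close>
  have "\<bar>(j - i) - (x2 - x1)\<bar> < int N * 2"
    using ij assms by auto
  hence "\<bar>q\<bar> < 2" unfolding q using N by (simp add: abs_mult)
  hence "q = 0 \<or> q = 1 \<or> q = -1" by auto
  hence dist: "nat \<bar>j - i\<bar> = n \<or> nat \<bar>j - i\<bar> = N - n"
    using q assms(1) ij unfolding n_def by auto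
  have "C (N - n) = C n"
    using assms by (simp add: C_def n_def algebra_simps)
  with dist have C: "C (nat \<bar>j - i\<bar>) = C n" by auto
  have "(\<Sum>\<sigma>\<in>spin_configs N. boltzmann_weight K N \<sigma> * real_of_int (\<sigma> i * \<sigma> j)) = C (nat \<bar>j - i\<bar>)"
  proof (cases "i \<le> j")
    case True
    thus ?thesis using sum_boltzmann_pair[of i j N K] ij by (simp add: C_def)
  next
    case False
    thus ?thesis using sum_boltzmann_pair[of j i N K] ij by (simp add: C_def mult.commute)
  qed
  thus ?thesis using C by (simp add: spin_def i_def j_def C_def)
qed

section \<open>Expectations of functions of two spins and their thermodynamic limit\<close>

lemma lambda_ratio: "lambda_minus K / lambda_plus K = tanh K"
  by (simp add: lambda_minus_def lambda_plus_def tanh_altdef)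

lemma ising_expectation_two_spins:
  fixes F :: "int \<Rightarrow> int \<Rightarrow> real" and K :: real
  assumes "N > nat \<bar>x2 - x1\<bar>"
  defines "n \<equiv> nat \<bar>x2 - x1\<bar>" and "t \<equiv> lambda_minus K / lambda_plus K"
  shows "ising_expectation K N (\<lambda>\<sigma>. F (spin N \<sigma> x1) (spin N \<sigma> x2)) =
    (F 1 1 + F (-1) 1 + F 1 (-1) + F (-1) (-1)) / 4 +
    (F 1 1 - F (-1) 1 - F 1 (-1) + F (-1) (-1)) / 4 * ((t ^ n + t ^ (N - n)) / (1 + t ^ N))"
proof -
  \<comment> \<open>These are the Fourier coefficients of \<open>F\<close> on pairs of signs: its
    averages against 1, the first spin, the second spin and their product.\<close>
  define \<alpha> where "\<alpha> = (F 1 1 + F (-1) 1 + F 1 (-1) + F (-1) (-1)) / 4"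
  define \<beta> where "\<beta> = (F 1 1 - F (-1) 1 + F 1 (-1) - F (-1) (-1)) / 4"
  define \<gamma> where "\<gamma> = (F 1 1 + F (-1) 1 - F 1 (-1) - F (-1) (-1)) / 4"
  define \<delta> where "\<delta> = (F 1 1 - F (-1) 1 - F 1 (-1) + F (-1) (-1)) / 4"
  note defs = \<alpha>_def \<beta>_def \<gamma>_def \<delta>_def
  have N: "N > 0" using assms by auto
  let ?w = "boltzmann_weight K N"
  have expand: "?w \<sigma> * F (spin N \<sigma> x1) (spin N \<sigma> x2) =
      \<alpha> * ?w \<sigma> + \<beta> * (?w \<sigma> * real_of_int (spin N \<sigma> x1)) + \<gamma> * (?w \<sigma> * real_of_int (spin N \<sigma> x2)) +
      \<delta> * (?w \<sigma> * real_of_int (spin N \<sigma> x1 * spin N \<sigma> x2))" if "\<sigma> \<in> spin_configs N" for \<sigma>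
    using spin_cases[OF N that, of x1] spin_cases[OF N that, of x2]
    by (auto simp: defs field_simps)
  have "(\<Sum>\<sigma>\<in>spin_configs N. ?w \<sigma> * F (spin N \<sigma> x1) (spin N \<sigma> x2)) =
      \<alpha> * partition_function K N +
      \<delta> * (2 ^ N * (cosh K ^ (N - n) * sinh K ^ n + sinh K ^ (N - n) * cosh K ^ n))"
  proof -
    have "(\<Sum>\<sigma>\<in>spin_configs N. ?w \<sigma> * F (spin N \<sigma> x1) (spin N \<sigma> x2)) =
        \<alpha> * (\<Sum>\<sigma>\<in>spin_configs N. ?w \<sigma>) +
        \<beta> * (\<Sum>\<sigma>\<in>spin_configs N. ?w \<sigma> * real_of_int (spin N \<sigma> x1)) +
        \<gamma> * (\<Sum>\<sigma>\<in>spin_configs N. ?w \<sigma> * real_of_int (spin N \<sigma> x2)) +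
        \<delta> * (\<Sum>\<sigma>\<in>spin_configs N. ?w \<sigma> * real_of_int (spin N \<sigma> x1 * spin N \<sigma> x2))"
      unfolding sum_distrib_left sum.distrib[symmetric]
      by (intro sum.cong refl) (rule expand)
    thus ?thesis
      unfolding sum_boltzmann_spin[OF N] sum_boltzmann_spin_spin[OF assms(1), folded n_def]
      by (simp add: partition_function_def)
  qed
  hence E: "ising_expectation K N (\<lambda>\<sigma>. F (spin N \<sigma> x1) (spin N \<sigma> x2)) = \<alpha> + \<delta> *
      ((2 ^ N * (cosh K ^ (N - n) * sinh K ^ n + sinh K ^ (N - n) * cosh K ^ n)) / partition_function K N)"
    using partition_function_pos[of K N] by (simp add: ising_expectation_eq field_simps)
  \<comment> \<open>Factoring \<open>cosh K ^ N\<close> out of numerator and denominator leaves only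
    powers of \<open>t\<close>; \<open>n < N\<close> makes the exponents \<open>N - n\<close> and
    \<open>n\<close> add up to \<open>N\<close>.\<close>
  have sinh: "sinh K = t * cosh K"
    using cosh_real_pos[of K] by (simp add: t_def lambda_ratio tanh_def)
  have cosh: "cosh K ^ (N - n) * cosh K ^ n = cosh K ^ N"
    using assms by (simp flip: power_add)
  have "cosh K ^ (N - n) * sinh K ^ n + sinh K ^ (N - n) * cosh K ^ n =
      (t ^ n + t ^ (N - n)) * (cosh K ^ (N - n) * cosh K ^ n)"
    unfolding sinh by (simp add: power_mult_distrib algebra_simps)
  hence num: "cosh K ^ (N - n) * sinh K ^ n + sinh K ^ (N - n) * cosh K ^ n =
      (t ^ n + t ^ (N - n)) * cosh K ^ N"
    unfolding cosh .
  have "cosh K ^ N + sinh K ^ N = (1 + t ^ N) * cosh K ^ N"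
    unfolding sinh by (simp add: power_mult_distrib algebra_simps)
  hence "(2 ^ N * (cosh K ^ (N - n) * sinh K ^ n + sinh K ^ (N - n) * cosh K ^ n)) / partition_function K N =
      (t ^ n + t ^ (N - n)) / (1 + t ^ N)"
    unfolding partition_function_eq[OF N] num using cosh_real_pos[of K] by simp
  thus ?thesis unfolding E by (simp add: defs)
qed

lemma ising_expectation_two_spins_tendsto:
  fixes F :: "int \<Rightarrow> int \<Rightarrow> real"
  shows "(\<lambda>N. ising_expectation K N (\<lambda>\<sigma>. F (spin N \<sigma> x1) (spin N \<sigma> x2))) \<longlonglongrightarrow>
    (F 1 1 + F (-1) 1 + F 1 (-1) + F (-1) (-1)) / 4 +
    (F 1 1 - F (-1) 1 - F 1 (-1) + F (-1) (-1)) / 4 *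
      (lambda_minus K / lambda_plus K) ^ nat \<bar>x2 - x1\<bar>"
proof -
  define t where "t = lambda_minus K / lambda_plus K"
  define n where "n = nat \<bar>x2 - x1\<bar>"
  have "\<bar>t\<bar> < 1"
    unfolding t_def lambda_ratio using tanh_real_bounds[of K] by auto
  hence t: "(\<lambda>N. t ^ N) \<longlonglongrightarrow> 0" by (intro LIMSEQ_power_zero) simp
  have t': "(\<lambda>N. t ^ (N - n)) \<longlonglongrightarrow> 0"
    \<comment> \<open>Shifting the index by \<open>n\<close> removes the truncated
      subtraction.\<close>
    by (rule LIMSEQ_offset[where k = n]) (use t in simp)
  have "(\<lambda>N. (t ^ n + t ^ (N - n)) / (1 + t ^ N)) \<longlonglongrightarrow> (t ^ n + 0) / (1 + 0)"
    by (intro tendsto_intros t t') simp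
  hence "(\<lambda>N. (F 1 1 + F (-1) 1 + F 1 (-1) + F (-1) (-1)) / 4 +
      (F 1 1 - F (-1) 1 - F 1 (-1) + F (-1) (-1)) / 4 * ((t ^ n + t ^ (N - n)) / (1 + t ^ N))) \<longlonglongrightarrow>
    (F 1 1 + F (-1) 1 + F 1 (-1) + F (-1) (-1)) / 4 +
      (F 1 1 - F (-1) 1 - F 1 (-1) + F (-1) (-1)) / 4 * t ^ n"
    by (intro tendsto_intros) simp
  \<comment> \<open>The finite-volume formula is available once the ring is longer than the distance
    of the sites, which suffices for the limit.\<close>
  moreover have "\<forall>\<^sub>F N in sequentially. N > n" by (rule eventually_gt_at_top)
  hence "\<forall>\<^sub>F N in sequentially.
    (F 1 1 + F (-1) 1 + F 1 (-1) + F (-1) (-1)) / 4 +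
      (F 1 1 - F (-1) 1 - F 1 (-1) + F (-1) (-1)) / 4 * ((t ^ n + t ^ (N - n)) / (1 + t ^ N)) =
    ising_expectation K N (\<lambda>\<sigma>. F (spin N \<sigma> x1) (spin N \<sigma> x2))"
    by eventually_elim
       (use ising_expectation_two_spins in \<open>simp add: t_def n_def\<close>)
  ultimately show ?thesis
    unfolding t_def n_def by (rule Lim_transform_eventually)
qed

section \<open>Continuity of \<open>x * ln x\<close> and the two limits\<close>

text \<open>Away from 0 the logarithm is continuous; at 0 the factor \<open>x\<close> beats the
  logarithm from the right, matching the value \<open>0 * ln 0 = 0\<close>. This covers a limiting
  mean of 0, as for vanishing \<open>f\<close>.\<close>

lemma tendsto_mult_ln_self:
  fixes u :: "'a \<Rightarrow> real"
  assumes "(u \<longlongrightarrow> L) F" "\<And>x. u x \<ge> 0"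
  shows "((\<lambda>x. u x * ln (u x)) \<longlongrightarrow> L * ln L) F"
proof (cases "L = 0")
  case False
  thus ?thesis by (intro tendsto_intros assms(1)) auto
next
  case True
  have "((\<lambda>x::real. x * ln x) \<longlongrightarrow> 0) (at_right 0)" by real_asymp
  hence "((\<lambda>x::real. x * ln x) \<longlongrightarrow> 0 * ln 0) (at 0 within {0..})"
    by (simp add: at_within_Ici_at_right)
  hence "continuous (at 0 within {0..}) (\<lambda>x::real. x * ln x)"
    by (simp add: continuous_within)
  moreover have "\<forall>\<^sub>F x in F. u x \<in> {0..}" using assms(2) by simp
  ultimately show ?thesis
    using assms(1) True
    by (intro continuous_within_tendsto_compose[where f = "\<lambda>x. x * ln x" and S = "{0..}"]) auto
qed

theorem theorem3p1:
  fixes K :: real and f g :: "int \<Rightarrow> real" and x1 x2 :: int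
    and a b c d A B C2 C4 \<Delta> :: real
  assumes "K > 0"
    and "a = (f 1)\<^sup>2 * (g 1)\<^sup>2 * ln ((f 1)\<^sup>2 * (g 1)\<^sup>2)"
    and "b = (f (- 1))\<^sup>2 * (g 1)\<^sup>2 * ln ((f (- 1))\<^sup>2 * (g 1)\<^sup>2)"
    and "c = (f 1)\<^sup>2 * (g (- 1))\<^sup>2 * ln ((f 1)\<^sup>2 * (g (- 1))\<^sup>2)"
    and "d = (f (- 1))\<^sup>2 * (g (- 1))\<^sup>2 * ln ((f (- 1))\<^sup>2 * (g (- 1))\<^sup>2)"
    and "A = a + b + c + d"
    and "B = a - b - c + d"
    and "C2 = (g 1)\<^sup>2 + (g (- 1))\<^sup>2"
    and "C4 = (f 1)\<^sup>2 + (f (- 1))\<^sup>2"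
    and "\<Delta> = ((f 1)\<^sup>2 - (f (- 1))\<^sup>2) * ((g 1)\<^sup>2 - (g (- 1))\<^sup>2)"
  shows "convergent (S_hat_seq K f g x1 x2) \<and>
         S_hat K f g x1 x2 =
           A / 4 + B / 4 * (lambda_minus K / lambda_plus K) ^ nat \<bar>x2 - x1\<bar> \<and>
         convergent (S_tilde_seq K f g x1 x2) \<and>
         S_tilde K f g x1 x2 =
           (C4 * C2 / 4 + \<Delta> / 4 * (lambda_minus K / lambda_plus K) ^ nat \<bar>x2 - x1\<bar>) *
           ln (C4 * C2 / 4 + \<Delta> / 4 * (lambda_minus K / lambda_plus K) ^ nat \<bar>x2 - x1\<bar>)"
proof -
  let ?r = "(lambda_minus K / lambda_plus K) ^ nat \<bar>x2 - x1\<bar>"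
  let ?L = "C4 * C2 / 4 + \<Delta> / 4 * ?r"
  let ?E = "\<lambda>N. ising_expectation K N (\<lambda>\<sigma>. (f (spin N \<sigma> x1))\<^sup>2 * (g (spin N \<sigma> x2))\<^sup>2)"
  \<comment> \<open>For this \<open>F\<close> the values \<open>F 1 1\<close>,
    \<open>F (-1) 1\<close>, \<open>F 1 (-1)\<close>, \<open>F (-1) (-1)\<close> are
    \<open>a\<close>, \<open>b\<close>, \<open>c\<close>, \<open>d\<close>.\<close>
  have hat: "S_hat_seq K f g x1 x2 \<longlonglongrightarrow> A / 4 + B / 4 * ?r"
    unfolding S_hat_seq_def assms(2-7)
    by (rule ising_expectation_two_spins_tendsto[
          where F = "\<lambda>s s'. (f s)\<^sup>2 * (g s')\<^sup>2 * ln ((f s)\<^sup>2 * (g s')\<^sup>2)"])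
  \<comment> \<open>For the product \<open>F\<close> of a function of each spin, the plain sum of
    the four values and the sum weighted by the product of the signs both factorize.\<close>
  have coeffs:
    "((f 1)\<^sup>2 * (g 1)\<^sup>2 + (f (-1))\<^sup>2 * (g 1)\<^sup>2 + (f 1)\<^sup>2 * (g (-1))\<^sup>2 + (f (-1))\<^sup>2 * (g (-1))\<^sup>2) = C4 * C2"
    "((f 1)\<^sup>2 * (g 1)\<^sup>2 - (f (-1))\<^sup>2 * (g 1)\<^sup>2 - (f 1)\<^sup>2 * (g (-1))\<^sup>2 + (f (-1))\<^sup>2 * (g (-1))\<^sup>2) = \<Delta>"
    unfolding assms(8-10) by (simp_all add: algebra_simps)
  have "?E \<longlonglongrightarrow> ?L"
    using ising_expectation_two_spins_tendsto[of K "\<lambda>s s'. (f s)\<^sup>2 * (g s')\<^sup>2" x1 x2]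
    unfolding coeffs .
  moreover have "?E N \<ge> 0" for N
    unfolding ising_expectation_def by (intro integral_nonneg_AE) auto
  ultimately have tilde: "S_tilde_seq K f g x1 x2 \<longlonglongrightarrow> ?L * ln ?L"
    unfolding S_tilde_seq_def by (rule tendsto_mult_ln_self)
  show ?thesis
    using limI[OF hat] limI[OF tilde] hat tilde
    by (auto simp: S_hat_def S_tilde_def convergent_def)
qed

end
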